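(* Consider the heterogeneous discrete Bass model on a one-sided circle with $M$ nodes, where each nonadopter $j$ adopts at rate $p_j+q_jX_{j-1}(t)$. Let $[S_k^j](t)$ be the probability that the $k$ consecutive nodes $j-k+1,j-k+2,\dots,j$ are all nonadopters at time $t$. Then for any $1\le j\le M$, $$\frac{d}{dt}[S_k^j](t)=-\Big(\Big(\sum_{i=j-k+1}^j p_i\Big)+q_{j-k+1}\Big)[S_k^j](t)+q_{j-k+1}[S_{k+1}^j](t),\qquad k=1,\dots,M-1,$$ and $$\frac{d}{dt}[S_M^j](t)=\Big(-\sum_{i=1}^M p_i\Big)[S_M^j](t),$$ with initial conditions $[S_k^j](0)=1$ for $k=1,\dots,M$.
   Context: One-sided circle model: nodes $1,\dots,M$ with external rates $p_j\ge0$ and internal rates $q_j\ge 0$. $X_j(t)\in\{0,1\}$ is the state of node $j$ ($1$ = adopter, $0$ = nonadopter), $X_j(0)=0$ for all $j$. The process $(X_1,\dots,X_M)$ is a continuous-time Markov chain in which adopters remain adopters forever, and each nonadopter $j$ becomes an adopter at rate $p_j+q_jX_{j-1}(t)$ (one node changes at a time), i.e. each node is influenced only by its left neighbor. Node subscripts are understood modulo $M$, in $\{1,\dots,M\}$ (e.g. node $0$ is node $M$). *)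

theory Defs
  imports "HOL-Probability.Probability"
begin

text \<open>Node subscripts are integers, reduced modulo \<open>M\<close> to a representative in \<open>{1..M}\<close>.\<close>

definition node :: "nat \<Rightarrow> int \<Rightarrow> int" where
  "node M i = (i - 1) mod int M + 1"

text \<open>
  Transition functions on a finite state space: standard stochastic semigroups \<open>P\<close> whose
  right derivative at time 0 is the rate matrix \<open>Q\<close>, that is,
  \<open>P h x y = of_bool (x = y) + Q x y * h + o(h)\<close> as \<open>h\<close> decreases to 0.
\<close>

definition transition_function ::
  "'s set \<Rightarrow> ('s \<Rightarrow> 's \<Rightarrow> real) \<Rightarrow> (real \<Rightarrow> 's \<Rightarrow> 's \<Rightarrow> real) \<Rightarrow> bool" where
  "transition_function S Q P \<longleftrightarrow>
     (\<forall>t\<ge>0. \<forall>x\<in>S. \<forall>y\<in>S. 0 \<le> P t x y) \<and>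
     (\<forall>t\<ge>0. \<forall>x\<in>S. (\<Sum>y\<in>S. P t x y) = 1) \<and>
     (\<forall>x\<in>S. \<forall>y\<in>S. P 0 x y = of_bool (x = y)) \<and>
     (\<forall>s\<ge>0. \<forall>t\<ge>0. \<forall>x\<in>S. \<forall>z\<in>S. P (s + t) x z = (\<Sum>y\<in>S. P s x y * P t y z)) \<and>
     (\<forall>x\<in>S. \<forall>y\<in>S. ((\<lambda>h. P h x y) has_real_derivative Q x y) (at 0 within {0..}))"

text \<open>
  A time-homogeneous Markov chain \<open>(X t)\<close>, \<open>t \<ge> 0\<close>, with finite state space \<open>S\<close> and rate
  matrix \<open>Q\<close>. The Markov property is imposed for every finite history of positive probability;
  only for those is the conditional probability meaningful.
\<close>

definition continuous_time_markov_chain ::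
  "'w measure \<Rightarrow> 's set \<Rightarrow> ('s \<Rightarrow> 's \<Rightarrow> real) \<Rightarrow> (real \<Rightarrow> 'w \<Rightarrow> 's) \<Rightarrow> bool" where
  "continuous_time_markov_chain \<Omega> S Q X \<longleftrightarrow>
     prob_space \<Omega> \<and> finite S \<and>
     (\<forall>t\<ge>0. X t \<in> measurable \<Omega> (count_space S)) \<and>
     (\<exists>P. transition_function S Q P \<and>
       (\<forall>(n::nat) (\<tau>::nat \<Rightarrow> real) (\<xi>::nat \<Rightarrow> 's).
          0 \<le> \<tau> 0 \<and> (\<forall>i\<le>n. \<tau> i < \<tau> (Suc i)) \<and> (\<forall>i\<le>Suc n. \<xi> i \<in> S) \<and>
          \<P>(\<omega> in \<Omega>. \<forall>i\<le>n. X (\<tau> i) \<omega> = \<xi> i) > 0 \<longrightarrow>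
          \<P>(\<omega> in \<Omega>. X (\<tau> (Suc n)) \<omega> = \<xi> (Suc n) \<bar> \<forall>i\<le>n. X (\<tau> i) \<omega> = \<xi> i)
            = P (\<tau> (Suc n) - \<tau> n) (\<xi> n) (\<xi> (Suc n))))"

definition configs :: "nat \<Rightarrow> (int \<Rightarrow> nat) set" where
  "configs M = {1..int M} \<rightarrow>\<^sub>E {0, 1}"

text \<open>
  The jump rate from \<open>x\<close> to \<open>y \<noteq> x\<close>. The index set has at most one element, the node that
  adopts; it is empty, so the rate is 0, if \<open>y\<close> differs from \<open>x\<close> in several nodes or if an
  adopter of \<open>x\<close> is a nonadopter of \<open>y\<close>.
\<close>

definition jump_rate ::
  "nat \<Rightarrow> (int \<Rightarrow> real) \<Rightarrow> (int \<Rightarrow> real) \<Rightarrow> (int \<Rightarrow> nat) \<Rightarrow> (int \<Rightarrow> nat) \<Rightarrow> real" where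
  "jump_rate M p q x y =
     (\<Sum>j | j \<in> {1..int M} \<and> x j = 0 \<and> y = x(j := 1). p j + q j * real (x (node M (j - 1))))"

definition rate_matrix ::
  "nat \<Rightarrow> (int \<Rightarrow> real) \<Rightarrow> (int \<Rightarrow> real) \<Rightarrow> (int \<Rightarrow> nat) \<Rightarrow> (int \<Rightarrow> nat) \<Rightarrow> real" where
  "rate_matrix M p q x y =
     (if y = x then - (\<Sum>z\<in>configs M - {x}. jump_rate M p q x z) else jump_rate M p q x y)"

text \<open>
  \<open>X t \<omega> j\<close> is the state of node \<open>j\<close> at time \<open>t\<close>. Up to null sets, the last condition already
  follows from the vanishing rates.
\<close>

definition one_sided_circle_bass ::
  "'w measure \<Rightarrow> nat \<Rightarrow> (int \<Rightarrow> real) \<Rightarrow> (int \<Rightarrow> real) \<Rightarrow> (real \<Rightarrow> 'w \<Rightarrow> int \<Rightarrow> nat) \<Rightarrow> bool" where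
  "one_sided_circle_bass \<Omega> M p q X \<longleftrightarrow>
     (\<forall>j\<in>{1..int M}. 0 \<le> p j \<and> 0 \<le> q j) \<and>
     continuous_time_markov_chain \<Omega> (configs M) (rate_matrix M p q) X \<and>
     (AE \<omega> in \<Omega>. \<forall>j\<in>{1..int M}. X 0 \<omega> j = 0) \<and>
     (\<forall>j\<in>{1..int M}. \<forall>s t. 0 \<le> s \<and> s \<le> t \<longrightarrow> (AE \<omega> in \<Omega>. X s \<omega> j = 1 \<longrightarrow> X t \<omega> j = 1))"

definition S_prob ::
  "'w measure \<Rightarrow> nat \<Rightarrow> (real \<Rightarrow> 'w \<Rightarrow> int \<Rightarrow> nat) \<Rightarrow> nat \<Rightarrow> int \<Rightarrow> real \<Rightarrow> real" where
  "S_prob \<Omega> M X k j t =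
     \<P>(\<omega> in \<Omega>. \<forall>i\<in>{j - int k + 1..j}. X t \<omega> (node M i) = 0)"

end

theory Submission
  imports Defs
begin

text \<open>
  The law of the chain at time \<open>t\<close> is the row of the transition function at the all-zero
  configuration, so by Kolmogorov's forward equation the expectation of any function \<open>f\<close> of
  the configuration has derivative \<open>E (Q f)\<close>. For the indicator that a block of consecutive nodes
  is vacant, \<open>Q f\<close> is minus the total adoption rate of the block, and inside a vacant block only
  the first node can feel an adopting left neighbour. That neighbour is an adopter exactly when
  the block extended by it is no longer vacant; if the block is the entire circle, the neighbour
  belongs to the block itself.
\<close>

section \<open>Kolmogorov's forward equation\<close>

lemma transition_function_le_1:
  assumes "transition_function S Q P" "finite S" "0 \<le> t" "x \<in> S" "y \<in> S"
  shows "P t x y \<le> 1"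
proof -
  have "P t x y \<le> (\<Sum>y\<in>S. P t x y)"
    using assms by (intro member_le_sum) (auto simp: transition_function_def)
  also have "\<dots> = 1"
    using assms by (auto simp: transition_function_def)
  finally show ?thesis .
qed

text \<open>In matrix form \<open>P (s + h) - P s = P s * (P h - I)\<close>. Increments at any time
  are thus reduced to the behaviour of \<open>P\<close> near time 0, the only time at which
  differentiability is assumed.\<close>

lemma transition_function_increment:
  assumes P: "transition_function S Q P" and S: "finite S"
    and "0 \<le> s" "0 \<le> h" "x \<in> S" "z \<in> S"
  shows "P (s + h) x z - P s x z = (\<Sum>y\<in>S. P s x y * (P h y z - of_bool (y = z)))"
proof -
  have "P (s + h) x z = (\<Sum>y\<in>S. P s x y * P h y z)"
    using assms by (auto simp: transition_function_def)
  moreover have "P s x z = (\<Sum>y\<in>S. P s x y * of_bool (y = z))"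
    using S \<open>z \<in> S\<close> by (simp add: of_bool_def sum.delta if_distrib cong: if_cong)
  ultimately show ?thesis
    by (simp add: right_diff_distrib sum_subtractf)
qed

text \<open>Transfers one-sided limits at 0 to an arbitrary time \<open>t\<close>, approached from
  either side.\<close>

lemma filterlim_abs_diff_at_0:
  fixes t :: real
  shows "filterlim (\<lambda>s. \<bar>s - t\<bar>) (at 0 within {0..}) (at t within A)"
  unfolding filterlim_at
proof
  show "((\<lambda>s. \<bar>s - t\<bar>) \<longlongrightarrow> 0) (at t within A)"
    by (rule tendsto_eq_intros refl)+ simp
qed (auto simp: eventually_at_filter)

lemma transition_function_continuous_at_0:
  assumes "transition_function S Q P" "x \<in> S" "y \<in> S"
  shows "((\<lambda>h. P h x y) \<longlongrightarrow> of_bool (x = y)) (at 0 within {0..})"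
proof -
  have "((\<lambda>h. P h x y) has_real_derivative Q x y) (at 0 within {0..})" "P 0 x y = of_bool (x = y)"
    using assms by (auto simp: transition_function_def)
  then show ?thesis
    using DERIV_continuous continuous_within by metis
qed

text \<open>Only \<open>s\<close> below \<open>t\<close> matters, so this is left continuity. The
  increment over \<open>t - s\<close> is a combination of the entries of
  \<open>P (t - s) - I\<close> with weights \<open>P s x y\<close> in [0,1]. Bounding the weights by
  1 leaves \<open>g\<close>, which tends to 0 by continuity at time 0.\<close>

lemma transition_function_tendsto_min:
  assumes P: "transition_function S Q P" and S: "finite S" and t: "0 \<le> t" and x: "x \<in> S" and z: "z \<in> S"
  shows "((\<lambda>s. P (min s t) x z) \<longlongrightarrow> P t x z) (at t within {0..})"
proof (rule LIM_zero_cancel, rule Lim_null_comparison)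
  define g where "g s = (\<Sum>y\<in>S. \<bar>P \<bar>s - t\<bar> y z - of_bool (y = z)\<bar>)" for s
  have "((\<lambda>s. P \<bar>s - t\<bar> y z) \<longlongrightarrow> of_bool (y = z)) (at t within {0..})" if "y \<in> S" for y
    using filterlim_compose[OF transition_function_continuous_at_0[OF P that z] filterlim_abs_diff_at_0] .
  then have "(g \<longlongrightarrow> (\<Sum>y\<in>S. \<bar>of_bool (y = z) - of_bool (y = z)\<bar>)) (at t within {0..})"
    unfolding g_def by (intro tendsto_intros)
  then show "(g \<longlongrightarrow> 0) (at t within {0..})"
    by simp
  have "norm (P (min s t) x z - P t x z) \<le> g s" if "0 \<le> s" for s
  proof (cases "s \<le> t")
    case True
    have "P t x z - P s x z = (\<Sum>y\<in>S. P s x y * (P (t - s) y z - of_bool (y = z)))"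
      using transition_function_increment[OF P S \<open>0 \<le> s\<close> _ x z, of "t - s"] True by simp
    then have "\<bar>P s x z - P t x z\<bar> = \<bar>\<Sum>y\<in>S. P s x y * (P (t - s) y z - of_bool (y = z))\<bar>"
      by (simp add: abs_minus_commute)
    also have "\<dots> \<le> (\<Sum>y\<in>S. \<bar>P s x y * (P (t - s) y z - of_bool (y = z))\<bar>)"
      by (rule sum_abs)
    also have "\<dots> \<le> (\<Sum>y\<in>S. \<bar>P (t - s) y z - of_bool (y = z)\<bar>)"
    proof (rule sum_mono)
      fix y assume y: "y \<in> S"
      have "0 \<le> P s x y"
        using P that x y by (auto simp: transition_function_def)
      with transition_function_le_1[OF P S that x y]
      show "\<bar>P s x y * (P (t - s) y z - of_bool (y = z))\<bar> \<le> \<bar>P (t - s) y z - of_bool (y = z)\<bar>"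
        by (simp add: abs_mult mult_left_le_one_le)
    qed
    finally show ?thesis
      using True by (simp add: g_def min_def abs_minus_commute[of s t])
  qed (auto simp: g_def sum_nonneg)
  then show "\<forall>\<^sub>F s in at t within {0..}. norm (P (min s t) x z - P t x z) \<le> g s"
    by (auto simp: eventually_at_filter)
qed

text \<open>
  The semigroup law is applied at time \<open>min s t\<close> with
  increment \<open>\<bar>s - t\<bar>\<close>, which treats the left and the right difference quotient at \<open>t\<close> at once.
\<close>

theorem kolmogorov_forward:
  assumes P: "transition_function S Q P" and S: "finite S" and t: "0 \<le> t" and x: "x \<in> S" and z: "z \<in> S"
  shows "((\<lambda>t. P t x z) has_real_derivative (\<Sum>y\<in>S. P t x y * Q y z)) (at t within {0..})"
  unfolding has_field_derivative_iff
proof (rule Lim_transform_eventually)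
  have "((\<lambda>h. (P h y z - of_bool (y = z)) / h) \<longlongrightarrow> Q y z) (at 0 within {0..})" if "y \<in> S" for y
  proof -
    have "((\<lambda>h. P h y z) has_real_derivative Q y z) (at 0 within {0..})" "P 0 y z = of_bool (y = z)"
      using P that z by (auto simp: transition_function_def)
    then show ?thesis
      by (simp add: has_field_derivative_iff)
  qed
  from filterlim_compose[OF this filterlim_abs_diff_at_0]
  show "((\<lambda>s. \<Sum>y\<in>S. P (min s t) x y * ((P \<bar>s - t\<bar> y z - of_bool (y = z)) / \<bar>s - t\<bar>)) \<longlongrightarrow>
      (\<Sum>y\<in>S. P t x y * Q y z)) (at t within {0..})"
    by (intro tendsto_sum tendsto_mult transition_function_tendsto_min[OF P S t x]) auto
  have "(\<Sum>y\<in>S. P (min s t) x y * ((P \<bar>s - t\<bar> y z - of_bool (y = z)) / \<bar>s - t\<bar>))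
      = (P s x z - P t x z) / (s - t)" if "0 \<le> s" for s
  proof -
    have "(\<Sum>y\<in>S. P (min s t) x y * (P \<bar>s - t\<bar> y z - of_bool (y = z)))
        = P (min s t + \<bar>s - t\<bar>) x z - P (min s t) x z"
      using transition_function_increment[OF P S _ _ x z, of "min s t" "\<bar>s - t\<bar>"] t that by simp
    then have "(\<Sum>y\<in>S. P (min s t) x y * ((P \<bar>s - t\<bar> y z - of_bool (y = z)) / \<bar>s - t\<bar>))
        = (P (min s t + \<bar>s - t\<bar>) x z - P (min s t) x z) / \<bar>s - t\<bar>"
      by (simp flip: sum_divide_distrib)
    also have "\<dots> = (P s x z - P t x z) / (s - t)"
    proof (cases "s \<le> t")
      \<comment> \<open>Here numerator and denominator both change sign. At \<open>s = t\<close>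
        both quotients are 0, division by 0 being 0.\<close>
      case True
      have "(P t x z - P s x z) / (t - s) = (P s x z - P t x z) / (s - t)"
        using minus_divide_divide[of "P s x z - P t x z" "s - t"] by simp
      with True show ?thesis by (simp add: min_def abs_real_def)
    qed simp
    finally show ?thesis .
  qed
  then show "\<forall>\<^sub>F s in at t within {0..}.
      (\<Sum>y\<in>S. P (min s t) x y * ((P \<bar>s - t\<bar> y z - of_bool (y = z)) / \<bar>s - t\<bar>))
      = (P s x z - P t x z) / (s - t)"
    by (auto simp: eventually_at_filter)
qed

text \<open>The forward equations are combined with weights \<open>f z\<close>; exchanging the sums
  lets \<open>Q\<close> act on \<open>f\<close> instead of on the law.\<close>

corollary kolmogorov_forward_observable:
  assumes P: "transition_function S Q P" and S: "finite S" and t: "0 \<le> t" and x: "x \<in> S"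
  shows "((\<lambda>t. \<Sum>z\<in>S. P t x z * f z) has_real_derivative
           (\<Sum>y\<in>S. P t x y * (\<Sum>z\<in>S. Q y z * f z))) (at t within {0..})"
proof -
  have "((\<lambda>t. \<Sum>z\<in>S. P t x z * f z) has_real_derivative
      (\<Sum>z\<in>S. (\<Sum>y\<in>S. P t x y * Q y z) * f z)) (at t within {0..})"
    by (intro DERIV_sum DERIV_cmult_right kolmogorov_forward[OF P S t x])
  also have "(\<Sum>z\<in>S. (\<Sum>y\<in>S. P t x y * Q y z) * f z) = (\<Sum>y\<in>S. P t x y * (\<Sum>z\<in>S. Q y z * f z))"
    by (simp add: sum_distrib_left sum_distrib_right mult.assoc) (rule sum.swap)
  finally show ?thesis .
qed

section \<open>The chain started from a fixed state\<close>

text \<open>Conditioning on an almost sure event changes no probability, so the Markov property for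
  a history consisting of time 0 alone already determines the law at each later time.\<close>

lemma markov_chain_law:
  assumes X: "continuous_time_markov_chain \<Omega> S Q X"
    and x: "x \<in> S" and init: "AE \<omega> in \<Omega>. X 0 \<omega> = x"
  obtains P where "transition_function S Q P"
    and "\<And>t y. 0 \<le> t \<Longrightarrow> y \<in> S \<Longrightarrow> \<P>(\<omega> in \<Omega>. X t \<omega> = y) = P t x y"
proof -
  interpret prob_space \<Omega>
    using X by (simp add: continuous_time_markov_chain_def)
  have [measurable]: "X t \<in> measurable \<Omega> (count_space S)" if "0 \<le> t" for t
    using X that by (simp add: continuous_time_markov_chain_def)
  obtain P where P: "transition_function S Q P"
    and markov: "\<And>(n::nat) (\<tau>::nat \<Rightarrow> real) \<xi>.
      0 \<le> \<tau> 0 \<and> (\<forall>i\<le>n. \<tau> i < \<tau> (Suc i)) \<and> (\<forall>i\<le>Suc n. \<xi> i \<in> S) \<and>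
      \<P>(\<omega> in \<Omega>. \<forall>i\<le>n. X (\<tau> i) \<omega> = \<xi> i) > 0 \<Longrightarrow>
      \<P>(\<omega> in \<Omega>. X (\<tau> (Suc n)) \<omega> = \<xi> (Suc n) \<bar> \<forall>i\<le>n. X (\<tau> i) \<omega> = \<xi> i)
        = P (\<tau> (Suc n) - \<tau> n) (\<xi> n) (\<xi> (Suc n))"
    using X unfolding continuous_time_markov_chain_def by meson
  have ev: "{\<omega> \<in> space \<Omega>. X t \<omega> = y} \<in> sets \<Omega>" if "0 \<le> t" for t y
    using measurable_sets[of "X t" \<Omega> "count_space S" "{y} \<inter> S"] that
      measurable_space[of "X t" \<Omega> "count_space S"]
    by (auto simp: vimage_def Int_def conj_commute elim!: back_subst[of "\<lambda>A. A \<in> sets \<Omega>"])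
  have init1: "\<P>(\<omega> in \<Omega>. X 0 \<omega> = x) = 1"
    using init ev[of 0 x] by (subst prob_Collect_eq_1) auto
  have "\<P>(\<omega> in \<Omega>. X t \<omega> = y) = P t x y" if t: "0 \<le> t" and y: "y \<in> S" for t y
  proof (cases "t = 0")
    \<comment> \<open>The Markov property concerns strictly increasing times, so time 0 is settled
      from the initial condition and \<open>P 0 = I\<close>.\<close>
    case True
    have "\<P>(\<omega> in \<Omega>. X 0 \<omega> = y) = \<P>(\<omega> in \<Omega>. x = y)"
      using init by (intro finite_measure_eq_AE) (auto simp: ev elim!: eventually_mono)
    also have "\<dots> = of_bool (x = y)"
      by (simp add: prob_space)
    finally show ?thesis
      using True P x y by (auto simp: transition_function_def)
  next
    case False
    have "\<P>(\<omega> in \<Omega>. X t \<omega> = y \<bar> X 0 \<omega> = x) = P t x y"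
      using markov[of "\<lambda>i. if i = 0 then 0 else t" 0 "\<lambda>i. if i = 0 then x else y"] init1 x y t False
      by simp
    moreover have "\<P>(\<omega> in \<Omega>. X t \<omega> = y \<and> X 0 \<omega> = x) = \<P>(\<omega> in \<Omega>. X t \<omega> = y)"
      using init ev[OF t, of y] ev[of 0 x]
      by (intro finite_measure_eq_AE) (auto elim!: eventually_mono)
    ultimately show ?thesis
      by (simp add: cond_prob_def init1)
  qed
  with P show thesis
    by (rule that)
qed

text \<open>Keeping the indicator as a factor gives the sum the shape to which the forward equation
  for observables applies.\<close>

lemma (in finite_measure) measure_Collect_discrete:
  assumes X: "X \<in> measurable M (count_space S)" and "finite S"
  shows "measure M {\<omega> \<in> space M. R (X \<omega>)} = (\<Sum>y\<in>S. measure M {\<omega> \<in> space M. X \<omega> = y} * of_bool (R y))"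
proof -
  have "{\<omega> \<in> space M. R (X \<omega>)} = (\<Union>y\<in>{y\<in>S. R y}. {\<omega> \<in> space M. X \<omega> = y})"
    using measurable_space[OF X] by auto
  moreover have "{\<omega> \<in> space M. X \<omega> = y} \<in> sets M" if "y \<in> S" for y
    using measurable_sets[OF X, of "{y}"] that by (simp add: vimage_def Int_def conj_commute)
  ultimately have "measure M {\<omega> \<in> space M. R (X \<omega>)}
      = (\<Sum>y\<in>{y\<in>S. R y}. measure M {\<omega> \<in> space M. X \<omega> = y})"
    using \<open>finite S\<close> by (auto intro!: finite_measure_finite_Union simp: disjoint_family_on_def)
  also have "\<dots> = (\<Sum>y\<in>S. measure M {\<omega> \<in> space M. X \<omega> = y} * of_bool (R y))"
    using \<open>finite S\<close> by (simp add: of_bool_def if_distrib sum.inter_filter cong: if_cong)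
  finally show ?thesis .
qed

section \<open>The generator of the circle model\<close>

lemma finite_configs: "finite (configs M)"
  by (auto simp: configs_def intro: finite_PiE)

lemma configs_upd: "x \<in> configs M \<Longrightarrow> i \<in> {1..int M} \<Longrightarrow> x(i := 1) \<in> configs M"
  by (auto simp: configs_def PiE_def extensional_def Pi_def)

text \<open>The rows of the rate matrix sum to 0, so only the differences \<open>f y - f x\<close>
  count, and the only states reached from \<open>x\<close> are those with one further
  adopter.\<close>

lemma rate_matrix_observable:
  fixes f :: "(int \<Rightarrow> nat) \<Rightarrow> real"
  assumes x: "x \<in> configs M"
  shows "(\<Sum>y\<in>configs M. rate_matrix M p q x y * f y) =
    (\<Sum>i | i \<in> {1..int M} \<and> x i = 0.
       (p i + q i * real (x (node M (i - 1)))) * (f (x(i := 1)) - f x))"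
proof -
  let ?C = "configs M" and ?I = "{i. i \<in> {1..int M} \<and> x i = 0}"
  let ?r = "\<lambda>i. p i + q i * real (x (node M (i - 1)))"
  have fin: "finite ?I"
    by (rule finite_subset[of _ "{1..int M}"]) auto
  \<comment> \<open>The condition on \<open>y\<close> moves from the index set into the summand, so
    that the sums over states and nodes can be exchanged.\<close>
  have jr: "jump_rate M p q x y = (\<Sum>i\<in>?I. if y = x(i := 1) then ?r i else 0)" for y
    unfolding jump_rate_def sum.inter_filter[OF fin, symmetric] by (rule sum.cong) auto
  have "(\<Sum>y\<in>?C. rate_matrix M p q x y * f y) =
      rate_matrix M p q x x * f x + (\<Sum>y\<in>?C - {x}. rate_matrix M p q x y * f y)"
    using x finite_configs by (rule sum.remove[rotated])
  also have "(\<Sum>y\<in>?C - {x}. rate_matrix M p q x y * f y) = (\<Sum>y\<in>?C - {x}. jump_rate M p q x y * f y)"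
    by (intro sum.cong) (auto simp: rate_matrix_def)
  also have "rate_matrix M p q x x * f x + \<dots> = (\<Sum>y\<in>?C - {x}. jump_rate M p q x y * (f y - f x))"
    by (simp add: rate_matrix_def right_diff_distrib sum_subtractf sum_distrib_right)
  \<comment> \<open>The state \<open>x\<close> can be put back because its difference
    \<open>f x - f x\<close> is 0.\<close>
  also have "\<dots> = (\<Sum>y\<in>?C. jump_rate M p q x y * (f y - f x))"
    using x finite_configs by (simp add: sum.remove)
  also have "\<dots> = (\<Sum>y\<in>?C. \<Sum>i\<in>?I. if y = x(i := 1) then ?r i * (f y - f x) else 0)"
    unfolding jr sum_distrib_right by (intro sum.cong refl) auto
  also have "\<dots> = (\<Sum>i\<in>?I. \<Sum>y\<in>?C. if y = x(i := 1) then ?r i * (f y - f x) else 0)"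
    by (rule sum.swap)
  also have "\<dots> = (\<Sum>i\<in>?I. ?r i * (f (x(i := 1)) - f x))"
    using configs_upd[OF x] finite_configs by (intro sum.cong refl) (simp add: sum.delta)
  finally show ?thesis .
qed

section \<open>Vacant blocks\<close>

lemma node_range: "0 < M \<Longrightarrow> node M i \<in> {1..int M}"
  by (simp add: node_def add1_zle_eq)

lemma node_node_pred: "node M (node M i - 1) = node M (i - 1)"
  by (simp add: node_def mod_diff_left_eq)

lemma node_minus_circumference: "node M (i - int M) = node M i"
  using mod_diff_right_eq[of "i - 1" "int M" "int M"] by (simp add: node_def algebra_simps)

text \<open>Two indices of the block differ by less than \<open>M\<close>, so they are congruent
  modulo \<open>M\<close> only if equal.\<close>

lemma inj_on_node:
  assumes "k \<le> M"
  shows "inj_on (node M) {j - int k + 1..j}"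
proof (rule inj_onI)
  fix a b assume ab: "a \<in> {j - int k + 1..j}" "b \<in> {j - int k + 1..j}" and "node M a = node M b"
  then have "int M dvd (a - 1) - (b - 1)"
    by (simp add: node_def mod_eq_dvd_iff)
  moreover have "\<bar>a - b\<bar> < int M"
    using ab assms by auto
  ultimately show "a = b"
    using dvd_imp_le_int[of "a - b" "int M"] by force
qed

text \<open>Any \<open>M\<close> consecutive integers represent each node exactly once:
  \<open>node M\<close> is injective on them, and its image has as many elements as the
  circle.\<close>

lemma sum_node_circle:
  assumes "0 < M"
  shows "(\<Sum>i = j - int M + 1..j. f (node M i)) = (\<Sum>i = 1..int M. f i)"
proof -
  have inj: "inj_on (node M) {j - int M + 1..j}"
    by (rule inj_on_node) simp
  have "node M ` {j - int M + 1..j} = {1..int M}"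
    using card_image[OF inj] node_range[OF assms] by (intro card_subset_eq) auto
  then show ?thesis
    using sum.reindex[OF inj, of f] by simp
qed

text \<open>The event of \<open>S_prob\<close> as a predicate on configurations, so that its
  indicator can serve as an observable.\<close>

definition vacant :: "nat \<Rightarrow> nat \<Rightarrow> int \<Rightarrow> (int \<Rightarrow> nat) \<Rightarrow> bool" where
  "vacant M k j x \<longleftrightarrow> (\<forall>i\<in>{j - int k + 1..j}. x (node M i) = 0)"

lemma vacant_Suc: "vacant M (Suc k) j x \<longleftrightarrow> x (node M (j - int k)) = 0 \<and> vacant M k j x"
proof -
  have "{j - int (Suc k) + 1..j} = insert (j - int k) {j - int k + 1..j}"
    by auto
  then show ?thesis
    by (simp add: vacant_def)
qed

text \<open>The state of the left neighbour stays explicit, so one formula covers both proper blocks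
  and the whole circle.\<close>

lemma rate_matrix_vacant:
  assumes x: "x \<in> configs M" and k: "1 \<le> k" "k \<le> M"
  shows "(\<Sum>y\<in>configs M. rate_matrix M p q x y * of_bool (vacant M k j y)) =
    - ((\<Sum>i = j - int k + 1..j. p (node M i))
        + q (node M (j - int k + 1)) * real (x (node M (j - int k)))) * of_bool (vacant M k j x)"
proof (cases "vacant M k j x")
  case False
  \<comment> \<open>An adoption never makes an occupied block vacant, so all differences of the
    indicator are 0.\<close>
  then have "\<not> vacant M k j (x(i := 1))" for i
    by (auto simp: vacant_def)
  with False show ?thesis
    by (simp add: rate_matrix_observable[OF x])
next
  case True
  let ?J = "{j - int k + 1..j}"
  let ?I = "{i. i \<in> {1..int M} \<and> x i = 0}"
  let ?r = "\<lambda>i. p i + q i * real (x (node M (i - 1)))"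
  have sub: "node M ` ?J \<subseteq> ?I"
    using True node_range[of M] k by (auto simp: vacant_def)
  have fin: "finite ?I"
    by (rule finite_subset[of _ "{1..int M}"]) auto
  have upd: "vacant M k j (x(i := 1)) \<longleftrightarrow> i \<notin> node M ` ?J" for i
    using True by (auto simp: vacant_def)
  have "(\<Sum>y\<in>configs M. rate_matrix M p q x y * of_bool (vacant M k j y))
      = (\<Sum>i\<in>?I. ?r i * (of_bool (vacant M k j (x(i := 1))) - of_bool (vacant M k j x)))"
    by (rule rate_matrix_observable[OF x])
  \<comment> \<open>An adoption inside the block lowers the indicator from 1 to 0; one outside
    leaves it unchanged.\<close>
  also have "\<dots> = (\<Sum>i\<in>?I. if i \<in> node M ` ?J then - ?r i else 0)"
    by (intro sum.cong refl) (simp add: upd True del: One_nat_def)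
  also have "\<dots> = (\<Sum>i\<in>node M ` ?J. - ?r i)"
    using sub by (subst sum.inter_restrict[OF fin, symmetric]) (simp add: Int_absorb1)
  also have "\<dots> = - (\<Sum>i\<in>?J. p (node M i) + q (node M i) * real (x (node M (i - 1))))"
    by (simp add: sum.reindex[OF inj_on_node[OF k(2)]] node_node_pred flip: sum_negf)
  also have "(\<Sum>i\<in>?J. p (node M i) + q (node M i) * real (x (node M (i - 1))))
      = (\<Sum>i\<in>?J. p (node M i)) + (\<Sum>i\<in>?J. q (node M i) * real (x (node M (i - 1))))"
    by (rule sum.distrib)
  \<comment> \<open>Every node of the block but the first has its left neighbour in the block, hence
    in state 0.\<close>
  also have "(\<Sum>i\<in>?J. q (node M i) * real (x (node M (i - 1))))
      = (\<Sum>i\<in>{j - int k + 1}. q (node M i) * real (x (node M (i - 1))))"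
    using True k by (intro sum.mono_neutral_right) (auto simp: vacant_def)
  finally show ?thesis
    using True by simp
qed

theorem lemma11:
  fixes \<Omega> :: "'w measure"
    and M :: nat
    and p q :: "int \<Rightarrow> real"
    and X :: "real \<Rightarrow> 'w \<Rightarrow> int \<Rightarrow> nat"
    and j :: int
  assumes "one_sided_circle_bass \<Omega> M p q X"
    and "1 \<le> j" and "j \<le> int M"
  shows "(\<forall>k t. 1 \<le> k \<and> k \<le> M - 1 \<and> 0 \<le> t \<longrightarrow>
            (S_prob \<Omega> M X k j has_real_derivative
               - ((\<Sum>i = j - int k + 1..j. p (node M i)) + q (node M (j - int k + 1)))
                   * S_prob \<Omega> M X k j t
               + q (node M (j - int k + 1)) * S_prob \<Omega> M X (k + 1) j t)
             (at t within {0..}))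
       \<and> (\<forall>t. 0 \<le> t \<longrightarrow>
            (S_prob \<Omega> M X M j has_real_derivative
               (- (\<Sum>i = 1..int M. p i)) * S_prob \<Omega> M X M j t)
             (at t within {0..}))
       \<and> (\<forall>k. 1 \<le> k \<and> k \<le> M \<longrightarrow> S_prob \<Omega> M X k j 0 = 1)"
proof -
  let ?C = "configs M" and ?Q = "rate_matrix M p q"
  \<comment> \<open>The restricted function is \<open>undefined\<close> off the circle, as
    membership in \<open>configs M\<close> demands.\<close>
  define x0 :: "int \<Rightarrow> nat" where "x0 = (\<lambda>i\<in>{1..int M}. 0)"
  have M: "0 < M"
    using assms by simp
  have chain: "continuous_time_markov_chain \<Omega> ?C ?Q X"
    and init: "AE \<omega> in \<Omega>. \<forall>j\<in>{1..int M}. X 0 \<omega> j = 0"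
    using assms(1) by (auto simp: one_sided_circle_bass_def)
  interpret prob_space \<Omega>
    using chain by (simp add: continuous_time_markov_chain_def)
  have meas: "X t \<in> measurable \<Omega> (count_space ?C)" if "0 \<le> t" for t
    using chain that by (simp add: continuous_time_markov_chain_def)
  have x0: "x0 \<in> ?C"
    by (auto simp: x0_def configs_def)
  have "AE \<omega> in \<Omega>. X 0 \<omega> = x0"
    using init AE_space
  proof eventually_elim
    case (elim \<omega>)
    then have "X 0 \<omega> \<in> {1..int M} \<rightarrow>\<^sub>E {0, 1}"
      using measurable_space[OF meas[of 0]] by (simp add: configs_def)
    \<comment> \<open>The initial condition fixes the values on the nodes; extensionality of
      configurations fixes the rest.\<close>
    then show ?case
      using elim x0 by (intro PiE_ext[of _ "{1..int M}" "\<lambda>_. {0, 1}"]) (auto simp: x0_def configs_def)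
  qed
  then obtain P where P: "transition_function ?C ?Q P"
    and law: "\<And>t y. 0 \<le> t \<Longrightarrow> y \<in> ?C \<Longrightarrow> \<P>(\<omega> in \<Omega>. X t \<omega> = y) = P t x0 y"
    using markov_chain_law[OF chain x0] by blast
  have S_eq: "S_prob \<Omega> M X k j t = (\<Sum>y\<in>?C. P t x0 y * of_bool (vacant M k j y))" if "0 \<le> t" for k t
    using measure_Collect_discrete[OF meas[OF that] finite_configs, of "vacant M k j"] law that
    by (simp add: S_prob_def vacant_def)
  \<comment> \<open>The formula \<open>S_eq\<close> holds for nonnegative times only, which suffices
    for the derivative within \<open>{0..}\<close>.\<close>
  have deriv: "(S_prob \<Omega> M X k j has_real_derivative
      (\<Sum>y\<in>?C. P t x0 y * (\<Sum>z\<in>?C. ?Q y z * of_bool (vacant M k j z)))) (at t within {0..})"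
    if "0 \<le> t" for k t
    by (rule has_field_derivative_transform_within[OF kolmogorov_forward_observable[OF P finite_configs that x0] zero_less_one])
      (use that S_eq in auto)
  have "(S_prob \<Omega> M X k j has_real_derivative
      - ((\<Sum>i = j - int k + 1..j. p (node M i)) + q (node M (j - int k + 1))) * S_prob \<Omega> M X k j t
      + q (node M (j - int k + 1)) * S_prob \<Omega> M X (k + 1) j t) (at t within {0..})"
    if k: "1 \<le> k" "k \<le> M - 1" and t: "0 \<le> t" for k t
  proof -
    let ?p = "\<Sum>i = j - int k + 1..j. p (node M i)" and ?q = "q (node M (j - int k + 1))"
    have "(\<Sum>z\<in>?C. ?Q y z * of_bool (vacant M k j z)) =
        - (?p + ?q) * of_bool (vacant M k j y) + ?q * of_bool (vacant M (k + 1) j y)"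
      if y: "y \<in> ?C" for y
    proof -
      \<comment> \<open>With neighbour state \<open>v\<close> in {0,1}, the longer block is vacant
        iff the shorter one is and \<open>v = 0\<close>. Its indicator is thus \<open>1 - v\<close>
        times the shorter one's, and \<open>- q * v = - q + q * (1 - v)\<close>.\<close>
      have "y (node M (j - int k)) \<in> {0, 1}"
        using y node_range[OF M] by (auto simp: configs_def PiE_def Pi_def)
      then show ?thesis
        using rate_matrix_vacant[OF y k(1), of p q j] k(2) by (auto simp: vacant_Suc)
    qed
    then have "(\<Sum>y\<in>?C. P t x0 y * (\<Sum>z\<in>?C. ?Q y z * of_bool (vacant M k j z)))
        = (\<Sum>y\<in>?C. P t x0 y *
            (- (?p + ?q) * of_bool (vacant M k j y) + ?q * of_bool (vacant M (k + 1) j y)))"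
      by (intro sum.cong refl) simp
    also have "\<dots> = - (?p + ?q) * S_prob \<Omega> M X k j t + ?q * S_prob \<Omega> M X (k + 1) j t"
      unfolding S_eq[OF t] by (simp only: distrib_left sum.distrib sum_distrib_left mult.left_commute)
    finally have "(\<Sum>y\<in>?C. P t x0 y * (\<Sum>z\<in>?C. ?Q y z * of_bool (vacant M k j z)))
        = - (?p + ?q) * S_prob \<Omega> M X k j t + ?q * S_prob \<Omega> M X (k + 1) j t" .
    with deriv[OF t, of k] show ?thesis
      by simp
  qed
  moreover have "(S_prob \<Omega> M X M j has_real_derivative
      (- (\<Sum>i = 1..int M. p i)) * S_prob \<Omega> M X M j t) (at t within {0..})" if t: "0 \<le> t" for t
  proof -
    have "(\<Sum>z\<in>?C. ?Q y z * of_bool (vacant M M j z)) =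
        - (\<Sum>i = 1..int M. p i) * of_bool (vacant M M j y)" if y: "y \<in> ?C" for y
    proof (cases "vacant M M j y")
      case True
      \<comment> \<open>One full turn to the left of \<open>j\<close> is \<open>j\<close> itself,
        which lies in the vacant block, so the internal rate contributes nothing.\<close>
      then have "y (node M (j - int M)) = 0"
        using M by (simp add: vacant_def node_minus_circumference)
      then show ?thesis
        using rate_matrix_vacant[OF y, of M p q j] M by (simp add: sum_node_circle)
    next
      case False
      then show ?thesis
        using rate_matrix_vacant[OF y, of M p q j] M by simp
    qed
    then have "(\<Sum>y\<in>?C. P t x0 y * (\<Sum>z\<in>?C. ?Q y z * of_bool (vacant M M j z)))
        = (\<Sum>y\<in>?C. P t x0 y * (- (\<Sum>i = 1..int M. p i) * of_bool (vacant M M j y)))"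
      by (intro sum.cong refl) simp
    also have "\<dots> = - (\<Sum>i = 1..int M. p i) * S_prob \<Omega> M X M j t"
      unfolding S_eq[OF t] by (simp only: sum_distrib_left mult.left_commute)
    finally have "(\<Sum>y\<in>?C. P t x0 y * (\<Sum>z\<in>?C. ?Q y z * of_bool (vacant M M j z)))
        = - (\<Sum>i = 1..int M. p i) * S_prob \<Omega> M X M j t" .
    with deriv[OF t, of M] show ?thesis
      by simp
  qed
  moreover have "S_prob \<Omega> M X k j 0 = 1" for k
  proof -
    have "vacant M k j x0"
      using node_range[OF M] by (auto simp: vacant_def x0_def)
    moreover have "P 0 x0 y = of_bool (x0 = y)" if "y \<in> ?C" for y
      using P that x0 by (auto simp: transition_function_def)
    ultimately have "S_prob \<Omega> M X k j 0 = (\<Sum>y\<in>?C. of_bool (x0 = y))"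
      unfolding S_eq[OF order_refl] by (intro sum.cong refl) auto
    also have "\<dots> = 1"
      using x0 finite_configs by (simp add: of_bool_def)
    finally show ?thesis .
  qed
  ultimately show ?thesis
    by blast
qed

end
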